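(* Let $K\subset(0,1)$ and $H\subset\mathbb R$ be compact. For $0<p<1$, $q=1-p$, $t\in\mathbb R$ and $k\ge1$ put $$\widehat A_k(t;p)=\frac{(-1)^{k+1}B_{k+1}-\Xi_k(p)\,\widehat B_{k+1}(t)}{k(k+1)},\qquad \widetilde A_k(t;p)=\frac{(-1)^{k+1}B_{k+1}-\Xi_k(p)\,B_{k+1}(t)}{k(k+1)}.$$ Then, as $N\to\infty$, uniformly for $p\in K$ and $t\in H$ such that $m:=Np+t\in\{0,1,\dots,N\}$, $$b(m;N,p)\sim\frac{1}{\sqrt{2\pi\,m(N-m)/N}}\,\exp\Bigl(\sum_{k\ge1}\frac{\widehat A_k(t;p)}{N^k}\Bigr),$$ in the following sense: for every integer $M\ge0$ there are constants $C$ and $N_0$, depending only on $M,K,H$, such that for all integers $N\ge N_0$ and all $p\in K$, $t\in H$ with $m=Np+t\in\{0,1,\dots,N\}$ one has $0<m<N$ and $$b(m;N,p)=\frac{1}{\sqrt{2\pi\,m(N-m)/N}}\,\exp\Bigl(\sum_{k=1}^{M}\frac{\widehat A_k(t;p)}{N^k}\Bigr)(1+\varepsilon),\qquad|\varepsilon|\le CN^{-M-1}.$$ Moreover, for all $0<p<1$, $t\in\mathbb R$ and $k\ge1$, $$\widehat A_k(t;p)=\widehat A_k(-t;q)\qquad\text{and}\qquad \widehat A_k(t;p)=\widetilde A_k(t;p)-\frac{\Xi_k(p)\,t^k}{2k}.$$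
   Context: $b(m;N,p)=\binom Nm p^m q^{N-m}$, with $q=1-p$, is the binomial probability mass. $B_n(t)$ are the Bernoulli polynomials, $\sum_{n\ge0}B_n(t)z^n/n!=\frac{z}{e^z-1}e^{tz}$, and $B_n=B_n(0)$ (so $B_1=-\tfrac12$). $\widehat B_n(t)=\tfrac12\bigl[B_n(t)+B_n(t+1)\bigr]$ for $n\ge0$ (equivalently $\sum_{n\ge0}\widehat B_n(t)z^n/n!=\frac z2\coth\frac z2\,e^{tz}$). For $k\ge1$, $\Xi_k(p)=\frac{(-1)^{k+1}}{p^k}+\frac1{q^k}$ with $q=1-p$; in an expression such as $\widehat A_k(-t;q)$ the roles of $p$ and $q$ are interchanged. *)

theory Defs
  imports "HOL-Probability.Probability" "HOL-Computational_Algebra.Formal_Power_Series"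
begin

definition binom_mass :: "nat \<Rightarrow> nat \<Rightarrow> real \<Rightarrow> real" where
  "binom_mass m N p = real (N choose m) * p ^ m * (1 - p) ^ (N - m)"

lemma binom_mass_eq_pmf:
  assumes "0 \<le> p" "p \<le> 1"
  shows "binom_mass m N p = pmf (binomial_pmf N p) m"
  using assms by (simp add: binom_mass_def)

(* B_n(t) is n! times the n-th coefficient of z / (e^z - 1) * e^(t z).  Both z and e^z - 1 have
   subdegree 1, so the quotient of formal power series is the genuine one; see
   bernpoly_generating_function. *)
definition bernpoly :: "nat \<Rightarrow> real \<Rightarrow> real" where
  "bernpoly n t = fact n * fps_nth (fps_X / (fps_exp 1 - 1) * fps_exp t) n"

lemma bernpoly_generating_function:
  "(fps_exp 1 - 1) * Abs_fps (\<lambda>n. bernpoly n t / fact n) = fps_X * fps_exp (t :: real)"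
proof -
  let ?E = "fps_exp 1 - 1 :: real fps"
  have nz: "fps_nth ?E 1 \<noteq> 0" "?E \<noteq> 0"
    by (auto simp: fps_eq_iff intro!: exI[of _ "Suc 0"])
  have "subdegree ?E \<le> 1"
    using nz by (intro subdegree_leI)
  then have "?E dvd fps_X"
    using nz by (subst fps_dvd_iff) auto
  then have "?E * (fps_X / ?E) = fps_X"
    by simp
  moreover have "Abs_fps (\<lambda>n. bernpoly n t / fact n) = fps_X / ?E * fps_exp t"
    by (simp add: bernpoly_def fps_eq_iff)
  ultimately show ?thesis
    by (metis mult.assoc)
qed

definition bernoulli :: "nat \<Rightarrow> real" where
  "bernoulli n = bernpoly n 0"

definition bernpoly_hat :: "nat \<Rightarrow> real \<Rightarrow> real" where
  "bernpoly_hat n t = (bernpoly n t + bernpoly n (t + 1)) / 2"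

definition Xi :: "nat \<Rightarrow> real \<Rightarrow> real" where
  "Xi k p = (- 1) ^ (k + 1) / p ^ k + 1 / (1 - p) ^ k"

definition A_hat :: "nat \<Rightarrow> real \<Rightarrow> real \<Rightarrow> real" where
  "A_hat k t p =
     ((- 1) ^ (k + 1) * bernoulli (k + 1) - Xi k p * bernpoly_hat (k + 1) t) / real (k * (k + 1))"

definition A_tilde :: "nat \<Rightarrow> real \<Rightarrow> real \<Rightarrow> real" where
  "A_tilde k t p =
     ((- 1) ^ (k + 1) * bernoulli (k + 1) - Xi k p * bernpoly (k + 1) t) / real (k * (k + 1))"

end

theory Submission
  imports Defs "HOL-Real_Asymp.Real_Asymp"
begin

text \<open>
  Telescoping in the integer \<open>m\<close> with \<open>t = m - z\<close> fixed gives a Stirling expansion of \<open>ln m! - (ln m)/2\<close>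
  in powers of \<open>1/z\<close>, uniform for bounded \<open>t\<close>: by the recurrence
  \<open>\<Sum>j\<le>n. (n+1 choose j) B_j(t) = (n+1) t^n\<close> the truncated expansion satisfies the difference
  equation of the left-hand side up to \<open>O(z^-(M+2))\<close>, and Wallis' product supplies the constant. The half-sums
  \<open>bernpoly_hat\<close> appear because of the term \<open>(ln m)/2\<close>, whose increment averages \<open>ln m\<close> and \<open>ln (m+1)\<close>.
  The theorem combines the expansions of \<open>N!\<close>, \<open>m!\<close> and \<open>(N-m)!\<close> with \<open>(z, t)\<close>
  equal to \<open>(N, 0)\<close>, \<open>(Np, t)\<close> and \<open>(Nq, -t)\<close>.
\<close>

subsection \<open>Bernoulli polynomials\<close>

definition bernpoly_egf :: "real \<Rightarrow> real fps" where
  "bernpoly_egf t = Abs_fps (\<lambda>n. bernpoly n t / fact n)"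

lemma bernpoly_egf_nth: "fps_nth (bernpoly_egf t) n = bernpoly n t / fact n"
  by (simp add: bernpoly_egf_def)

lemma bernpoly_egf: "(fps_exp 1 - 1) * bernpoly_egf t = fps_X * fps_exp t"
  using bernpoly_generating_function[of t] by (simp add: bernpoly_egf_def)

lemma fps_exp_minus_1_nonzero: "fps_exp 1 - 1 \<noteq> (0 :: real fps)"
  by (auto simp: fps_eq_iff intro!: exI[of _ "Suc 0"])

text \<open>Power series over a field have no zero divisors, so \<open>fps_exp 1 - 1\<close>
  cancels. Identities for \<open>bernpoly\<close> thus reduce to checking this functional
  equation.\<close>

lemma bernpoly_egf_unique:
  assumes "(fps_exp 1 - 1) * f = fps_X * fps_exp t"
  shows "f = bernpoly_egf t"
  using assms bernpoly_egf[of t] fps_exp_minus_1_nonzero by (metis mult_cancel_left)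

text \<open>Adding \<open>fps_X * fps_exp t\<close> to \<open>bernpoly_egf t\<close> multiplies the
  right-hand side of its functional equation by \<open>fps_exp 1\<close>, which gives the equation
  for \<open>t + 1\<close>.\<close>

lemma bernpoly_Suc_add_1: "bernpoly (Suc n) (t + 1) = bernpoly (Suc n) t + real (Suc n) * t ^ n"
proof -
  have "(fps_exp 1 - 1) * (bernpoly_egf t + fps_X * fps_exp t) = fps_X * fps_exp (t + 1)"
    by (simp only: distrib_left bernpoly_egf) (simp add: fps_exp_add_mult algebra_simps)
  from bernpoly_egf_unique[OF this]
  have "bernpoly_egf (t + 1) = bernpoly_egf t + fps_X * fps_exp t" by simp
  from arg_cong[OF this, of "\<lambda>f. fps_nth f (Suc n)"]
  have "bernpoly (Suc n) (t + 1) / fact (Suc n) = bernpoly (Suc n) t / fact (Suc n) + t ^ n / fact n"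
    by (simp add: bernpoly_egf_nth del: fact_Suc)
  also have "t ^ n / fact n = real (Suc n) * t ^ n / fact (Suc n)"
    by simp
  finally show ?thesis
    by (simp add: add_divide_distrib[symmetric] del: fact_Suc of_nat_Suc)
qed

text \<open>Substituting \<open>- fps_X\<close> in the functional equation and multiplying by
  \<open>- fps_exp 1\<close> gives the functional equation for \<open>1 - t\<close>.\<close>

lemma bernpoly_reflect: "bernpoly n (1 - t) = (-1) ^ n * bernpoly n t"
proof -
  have "(fps_exp 1 - 1) * bernpoly_egf t oo (- fps_X) = fps_X * fps_exp t oo (- fps_X)"
    by (simp add: bernpoly_egf)
  then have "(fps_exp (-1) - 1) * (bernpoly_egf t oo (- fps_X)) = - fps_X * fps_exp (-t)"
    by (simp add: fps_compose_mult_distrib fps_compose_sub_distrib)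
  then have "- fps_exp 1 * ((fps_exp (-1) - 1) * (bernpoly_egf t oo (- fps_X)))
      = - fps_exp 1 * (- fps_X * fps_exp (-t))" by simp
  then have "(fps_exp 1 - fps_exp 1 * fps_exp (-1)) * (bernpoly_egf t oo (- fps_X))
      = fps_X * (fps_exp 1 * fps_exp (-t))"
    by (simp add: algebra_simps)
  then have "(fps_exp 1 - 1) * (bernpoly_egf t oo (- fps_X)) = fps_X * fps_exp (1 - t)"
    by (simp add: fps_exp_add_mult[symmetric])
  from bernpoly_egf_unique[OF this]
  have "bernpoly_egf (1 - t) = bernpoly_egf t oo (- fps_X)" by simp
  from arg_cong[OF this, of "\<lambda>f. fps_nth f n"] show ?thesis
    by (simp add: bernpoly_egf_nth fps_compose_uminus')
qed

text \<open>Compare coefficients of degree \<open>Suc n\<close> in the functional equation. The term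
  with \<open>j = Suc n\<close> drops out because \<open>fps_exp 1 - 1\<close> has no constant
  term.\<close>

lemma sum_choose_bernpoly:
  "(\<Sum>j\<le>n. real (Suc n choose j) * bernpoly j t) = real (Suc n) * t ^ n"
proof -
  have "fps_nth (bernpoly_egf t * (fps_exp 1 - 1)) (Suc n) = fps_nth (fps_X * fps_exp t) (Suc n)"
    by (simp only: bernpoly_egf mult.commute[of "bernpoly_egf t"])
  also have "fps_nth (fps_X * fps_exp t) (Suc n) = t ^ n / fact n"
    by simp
  finally have "(\<Sum>j\<le>Suc n. bernpoly j t / fact j * fps_nth (fps_exp 1 - 1) (Suc n - j)) = t ^ n / fact n"
    by (simp only: fps_mult_nth bernpoly_egf_nth atLeast0AtMost)
  then have *: "(\<Sum>j\<le>n. bernpoly j t / fact j * fps_nth (fps_exp 1 - 1) (Suc n - j)) = t ^ n / fact n"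
    by (simp add: mult.commute)
  have "(\<Sum>j\<le>n. real (Suc n choose j) * bernpoly j t)
      = fact (Suc n) * (\<Sum>j\<le>n. bernpoly j t / fact j * fps_nth (fps_exp 1 - 1) (Suc n - j))"
    unfolding sum_distrib_left
  proof (intro sum.cong refl)
    fix j assume "j \<in> {..n}"
    then show "real (Suc n choose j) * bernpoly j t =
      fact (Suc n) * (bernpoly j t / fact j * fps_nth (fps_exp 1 - 1) (Suc n - j))"
      by (simp add: binomial_fact Suc_diff_le del: fact_Suc)
  qed
  also have "\<dots> = real (Suc n) * t ^ n"
    by (subst *) simp
  finally show ?thesis .
qed

lemma bernpoly_0: "bernpoly 0 t = 1"
  using sum_choose_bernpoly[of 0 t] by simp

lemma bernpoly_1: "bernpoly 1 t = t - 1 / 2"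
  using sum_choose_bernpoly[of 1 t] by (simp add: bernpoly_0)

lemma continuous_on_bernpoly: "continuous_on A (bernpoly n)"
proof -
  have "bernpoly n = (\<lambda>t. fact n *
    (\<Sum>i=0..n. fps_nth (fps_X / (fps_exp 1 - 1)) i * (t ^ (n - i) / fact (n - i))))"
    by (simp add: fun_eq_iff bernpoly_def fps_mult_nth)
  then show ?thesis by (auto intro!: continuous_intros)
qed

section \<open>Half-sums of Bernoulli polynomials: parity and recurrence\<close>

lemma bernpoly_hat_eq: "bernpoly_hat (Suc n) t = bernpoly (Suc n) t + real (Suc n) * t ^ n / 2"
  by (simp add: bernpoly_hat_def bernpoly_Suc_add_1[simplified])

text \<open>The reflection \<open>t\<close> to \<open>1 - t\<close> carries the arguments
  \<open>-t\<close> and \<open>1 - t\<close> to \<open>1 + t\<close> and \<open>t\<close>, so it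
  swaps the two halves of the sum.\<close>

lemma bernpoly_hat_minus: "bernpoly_hat n (- t) = (-1) ^ n * bernpoly_hat n t"
  using bernpoly_reflect[of n t] bernpoly_reflect[of n "1 + t"]
  by (simp add: bernpoly_hat_def algebra_simps)

text \<open>The correction term contains \<open>0 ^ k\<close>. For \<open>k = 0\<close> the two
  sides differ: they are 0 and -1/2.\<close>

lemma bernpoly_hat_at_0: "k \<ge> 1 \<Longrightarrow> bernpoly_hat (Suc k) 0 = bernoulli (Suc k)"
  by (simp add: bernpoly_hat_eq bernoulli_def)

text \<open>Continuity on a compact interval later bounds the coefficients of the expansion
  uniformly in \<open>t\<close>.\<close>

lemma continuous_on_bernpoly_hat: "continuous_on A (bernpoly_hat n)"
  unfolding bernpoly_hat_def[abs_def]
  by (intro continuous_intros continuous_on_bernpoly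
        continuous_on_compose2[OF continuous_on_bernpoly[of UNIV]]) auto

lemma sum_choose_bernpoly_hat:
  "(\<Sum>j\<le>n. real (Suc n choose j) * bernpoly_hat j t) = real (Suc n) * (t ^ n + (t + 1) ^ n) / 2"
  using sum_choose_bernpoly[of n t] sum_choose_bernpoly[of n "t + 1"]
  by (simp add: bernpoly_hat_def sum.distrib field_simps sum_divide_distrib[symmetric])

lemma bernpoly_hat_0: "bernpoly_hat 0 t = 1"
  and bernpoly_hat_1: "bernpoly_hat 1 t = t"
  using bernpoly_1[of t] bernpoly_1[of "t+1"] by (simp_all add: bernpoly_hat_def bernpoly_0 field_simps)

text \<open>The recurrence without its terms \<open>j = 0\<close> and \<open>j = 1\<close>, divided
  by \<open>n * (n + 1)\<close>. In this form it matches the coefficients produced by expanding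
  \<open>1 / (z + 1) ^ k\<close> in powers of \<open>1 / z\<close>.\<close>

lemma sum_choose_bernpoly_hat_interior:
  assumes "n \<ge> 1"
  shows "(\<Sum>k=1..<n. real (n - 1 choose (k - 1)) * bernpoly_hat (k + 1) t / real (k * (k + 1)))
    = (t ^ n + (t + 1) ^ n) / (2 * real n) - (1 + real (n + 1) * t) / real (n * (n + 1))"
proof -
  have "(\<Sum>k=1..<n. real (n - 1 choose (k - 1)) * bernpoly_hat (k + 1) t / real (k * (k + 1)))
      = (\<Sum>k=1..<n. real (Suc n choose (k + 1)) * bernpoly_hat (k + 1) t) / real (n * (n + 1))"
    unfolding sum_divide_distrib
  proof (intro sum.cong refl)
    fix k assume k: "k \<in> {1..<n}"
    obtain l where l: "k = Suc l" using k by (cases k) auto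
    obtain r where r: "n = Suc r" using k by (cases n) auto
    \<comment> \<open>The absorption identity, used twice, exchanges the weight
      \<open>k * (k + 1)\<close> for \<open>n * (n + 1)\<close>.\<close>
    have "Suc k * (Suc n choose Suc k) = Suc n * (n choose k)"
      by (metis Suc_times_binomial_eq mult.commute)
    moreover have "k * (n choose k) = n * (n - 1 choose (k - 1))"
      unfolding l r using Suc_times_binomial_eq[of r l] by (simp add: mult.commute)
    ultimately have "k * (Suc k * (Suc n choose Suc k)) = Suc n * (n * (n - 1 choose (k - 1)))"
      by (metis mult.left_commute)
    then have "k * (k + 1) * (Suc n choose (k + 1)) = n * (n + 1) * (n - 1 choose (k - 1))"
      by (simp only: Suc_eq_plus1 ac_simps)
    then have "real (k * (k + 1)) * real (Suc n choose (k + 1)) = real (n * (n + 1)) * real (n - 1 choose (k - 1))"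
      by (metis of_nat_mult)
    then have "real (n - 1 choose (k - 1)) / real (k * (k + 1)) = real (Suc n choose (k + 1)) / real (n * (n + 1))"
      using k by (simp add: field_simps del: of_nat_mult of_nat_add of_nat_Suc)
    then show "real (n - 1 choose (k - 1)) * bernpoly_hat (k + 1) t / real (k * (k + 1))
      = real (Suc n choose (k + 1)) * bernpoly_hat (k + 1) t / real (n * (n + 1))"
      by (metis times_divide_eq_left)
  qed
  also have "(\<Sum>k=1..<n. real (Suc n choose (k + 1)) * bernpoly_hat (k + 1) t)
      = (\<Sum>j=2..<Suc n. real (Suc n choose j) * bernpoly_hat j t)"
    using sum.shift_bounds_Suc_ivl[of "\<lambda>j. real (Suc n choose j) * bernpoly_hat j t" 1 n]
    by (simp add: numeral_2_eq_2)
  also have "\<dots> = real (Suc n) * (t ^ n + (t + 1) ^ n) / 2 - 1 - real (n + 1) * t"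
  proof -
    have "{..n} = insert 0 (insert 1 {2..<Suc n})" using assms by auto
    then have "(\<Sum>j\<le>n. real (Suc n choose j) * bernpoly_hat j t)
        = 1 + (real (n + 1) * t + (\<Sum>j=2..<Suc n. real (Suc n choose j) * bernpoly_hat j t))"
      by (simp add: bernpoly_hat_0 bernpoly_hat_1[simplified] del: sum.op_ivl_Suc)
    then show ?thesis unfolding sum_choose_bernpoly_hat by linarith
  qed
  also have "(real (Suc n) * (t ^ n + (t + 1) ^ n) / 2 - 1 - real (n + 1) * t) / real (n * (n + 1))
      = (t ^ n + (t + 1) ^ n) / (2 * real n) - (1 + real (n + 1) * t) / real (n * (n + 1))"
  proof -
    have "((1 + x) * A / 2 - 1 - B) / (x * (1 + x)) = A / (2 * x) - (1 + B) / (x * (1 + x))"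
      if "x > 0" for x A B :: real
    proof -
      have "(1 + x) * A / 2 / (x * (1 + x)) = A / (2 * x)"
        using that by (simp add: divide_simps)
      then show ?thesis by (simp add: diff_divide_distrib add_divide_distrib)
    qed
    note * = this[of "real n"]
    have e: "real (Suc n) = 1 + real n" "real (n + 1) = 1 + real n" "real (n * (n + 1)) = real n * (1 + real n)"
      by (simp_all add: algebra_simps)
    show ?thesis unfolding e by (rule *) (use assms in simp)
  qed
  finally show ?thesis .
qed

subsection \<open>Remainders of power series\<close>

text \<open>The remainder is \<open>x ^ (L + 1)\<close> times the shifted power series
  \<open>g\<close>, and \<open>g\<close> is continuous, hence bounded, near 0.\<close>

lemma powser_remainder_bigo:
  fixes a :: "nat \<Rightarrow> real"
  assumes "\<And>x. \<bar>x\<bar> < 1 \<Longrightarrow> (\<lambda>n. a n * x ^ n) sums f x"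
  shows "(\<lambda>x. f x - (\<Sum>n\<le>L. a n * x ^ n)) \<in> O[nhds 0](\<lambda>x. x ^ (L + 1))"
proof -
  define g where "g x = (\<Sum>n. a (n + (L + 1)) * x ^ n)" for x
  have eq: "f x - (\<Sum>n\<le>L. a n * x ^ n) = x ^ (L + 1) * g x" if "\<bar>x\<bar> < 1" for x
  proof (cases "x = 0")
    case True
    then show ?thesis using assms[of 0] powser_sums_zero[of a] sums_unique2 by fastforce
  next
    case False
    have "(\<lambda>n. a (n + (L + 1)) * x ^ (n + (L + 1))) sums (f x - (\<Sum>n<L + 1. a n * x ^ n))"
      using assms[OF that] by (rule sums_split_initial_segment)
    then have "(\<lambda>n. x ^ (L + 1) * (a (n + (L + 1)) * x ^ n)) sums (f x - (\<Sum>n<L + 1. a n * x ^ n))"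
      by (simp add: power_add mult_ac)
    then have "(\<lambda>n. a (n + (L + 1)) * x ^ n) sums ((f x - (\<Sum>n<L + 1. a n * x ^ n)) / x ^ (L + 1))"
      using False sums_divide[of _ _ "x ^ (L + 1)"] by fastforce
    then have "g x = (f x - (\<Sum>n<L + 1. a n * x ^ n)) / x ^ (L + 1)"
      unfolding g_def by (rule sums_unique[symmetric])
    then show ?thesis using False by (simp add: lessThan_Suc_atMost)
  qed
  \<comment> \<open>Convergence of the series for \<open>g\<close> at the single point 1/2 suffices
    for continuity at 0.\<close>
  have "summable (\<lambda>n. a n * (1/2) ^ n)"
    using assms[of "1/2"] by (simp add: sums_iff)
  then have "summable (\<lambda>n. a (n + (L + 1)) * (1/2) ^ (n + (L + 1)))"
    by (rule summable_ignore_initial_segment)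
  then have "summable (\<lambda>n. (a (n + (L + 1)) * (1/2) ^ n) * (1/2) ^ (L + 1))"
    by (simp add: power_add mult_ac)
  then have "summable (\<lambda>n. a (n + (L + 1)) * (1/2) ^ n)"
    using summable_mult_D[of "(1/2) ^ (L + 1)"] by (simp add: mult.commute)
  then have "isCont g 0"
    unfolding g_def by (rule isCont_powser) simp
  then have "g \<in> O[nhds 0](\<lambda>_. 1)"
    by (intro bigoI_tendsto[of _ _ "g 0"]) (auto simp: isCont_def tendsto_at_iff_tendsto_nhds)
  then have "(\<lambda>x. x ^ (L + 1) * g x) \<in> O[nhds 0](\<lambda>x. x ^ (L + 1) * 1)"
    by (intro landau_o.big.mult) auto
  moreover have "eventually (\<lambda>x. f x - (\<Sum>n\<le>L. a n * x ^ n) = x ^ (L + 1) * g x) (nhds 0)"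
  proof (rule eventually_mono[OF eventually_nhds_in_open[of "{-1<..<1}"]])
    fix x :: real assume "x \<in> {-1<..<1}"
    then show "f x - (\<Sum>n\<le>L. a n * x ^ n) = x ^ (L + 1) * g x" by (intro eq) auto
  qed simp_all
  ultimately show ?thesis by (subst landau_o.big.in_cong) auto
qed

lemma ln_remainder_bigo:
  \<comment> \<open>the summand for \<open>n = 0\<close> vanishes because \<open>x / 0 = 0\<close>\<close>
  "(\<lambda>x::real. ln (1 + x) - (\<Sum>n\<le>L. (-1) ^ (n + 1) / real n * x ^ n)) \<in> O[nhds 0](\<lambda>x. x ^ (L + 1))"
proof (rule powser_remainder_bigo)
  fix x :: real assume "\<bar>x\<bar> < 1"
  then have "(\<lambda>n. - ((-x) ^ n) / real n) sums ln (1 + x)" by (rule ln_series')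
  moreover have "- ((-x) ^ n) / real n = (-1) ^ (n + 1) / real n * x ^ n" for n
    by (subst power_minus) simp
  ultimately show "(\<lambda>n. (-1) ^ (n + 1) / real n * x ^ n) sums ln (1 + x)" by (simp only:)
qed

text \<open>This is the binomial series with exponent \<open>-k\<close>, its coefficients rewritten
  by negating the upper index.\<close>

lemma inverse_power_remainder_bigo:
  assumes "k \<ge> 1"
  shows "(\<lambda>x::real. 1 / (1 + x) ^ k - (\<Sum>n\<le>L. (-1) ^ n * real (k + n - 1 choose n) * x ^ n))
    \<in> O[nhds 0](\<lambda>x. x ^ (L + 1))"
proof (rule powser_remainder_bigo)
  fix x :: real assume x: "\<bar>x\<bar> < 1"
  have "(\<lambda>n. (- real k gchoose n) * x ^ n) sums (1 + x) powr (- real k)"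
    using x by (rule gen_binomial_real)
  moreover have "(1 + x) powr (- real k) = 1 / (1 + x) ^ k"
    using x by (simp add: powr_minus powr_realpow divide_inverse)
  moreover have "(- real k gchoose n) = (-1) ^ n * real (k + n - 1 choose n)" for n
    using assms by (simp add: gbinomial_minus binomial_gbinomial of_nat_diff)
  ultimately show "(\<lambda>n. (-1) ^ n * real (k + n - 1 choose n) * x ^ n) sums (1 / (1 + x) ^ k)" by simp
qed

subsection \<open>Stirling's formula from the Wallis product\<close>

text \<open>The increments of \<open>a\<close> are of order \<open>1 / n ^ 2\<close>, hence
  summable. This yields a limit but not its value.\<close>

lemma convergent_ln_fact_error:
  fixes a :: "nat \<Rightarrow> real"
  defines "a \<equiv> \<lambda>n. ln (fact n) - (real n + 1 / 2) * ln (real n) + real n"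
  shows "convergent a"
proof -
  have "(\<lambda>n. 1 - (real n + 1 / 2) * (ln (real n + 1) - ln (real n))) \<in> O(\<lambda>n. 1 / real n ^ 2)"
    by real_asymp
  moreover have "eventually (\<lambda>n. a (Suc n) - a n = 1 - (real n + 1 / 2) * (ln (real n + 1) - ln (real n))) at_top"
    using eventually_gt_at_top[of 0]
  proof eventually_elim
    case (elim n)
    have "ln (fact (Suc n) :: real) = ln (real n + 1) + ln (fact n)"
      by (simp add: ln_mult add_ac)
    then show ?case by (simp add: a_def algebra_simps del: fact_Suc)
  qed
  ultimately have "(\<lambda>n. a (Suc n) - a n) \<in> O(\<lambda>n. 1 / real n ^ 2)"
    by (simp add: landau_o.big.in_cong)
  moreover have "summable (\<lambda>n. norm (1 / real n ^ 2))"
    using inverse_power_summable[of 2, where ?'a = real] by (simp add: field_simps)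
  ultimately have "summable (\<lambda>n. a (Suc n) - a n)"
    by (rule summable_comparison_test_bigo[rotated])
  then have "convergent (\<lambda>n. a n - a 0)"
    by (simp add: summable_iff_convergent sum_lessThan_telescope)
  then show ?thesis by (simp add: convergent_diff_const_right_iff)
qed

text \<open>The partial Wallis product is \<open>2^(4n) n!^4 / ((2n)!^2 (2n+1))\<close>, by
  induction with \<open>4 k^2 - 1 = (2k - 1)(2k + 1)\<close>.\<close>

lemma ln_wallis_prod:
  "ln (\<Prod>k=1..n. (4 * real k ^ 2) / (4 * real k ^ 2 - 1))
    = 4 * real n * ln 2 + 4 * ln (fact n) - 2 * ln (fact (2 * n)) - ln (2 * real n + 1)"
proof (induction n)
  case (Suc n)
  have *: "4 * real (Suc n) ^ 2 - 1 = (2 * real n + 1) * (2 * real n + 3)"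
    by (simp add: power2_eq_square algebra_simps)
  have pos: "(\<Prod>k=1..n. (4 * real k ^ 2) / (4 * real k ^ 2 - 1)) > 0"
  proof (rule prod_pos)
    fix k assume "k \<in> {1..n}"
    then have "real k ^ 2 \<ge> 1" by simp
    then show "4 * (real k)\<^sup>2 / (4 * (real k)\<^sup>2 - 1) > 0"
      by (intro divide_pos_pos) linarith+
  qed
  have "ln (\<Prod>k=1..Suc n. (4 * real k ^ 2) / (4 * real k ^ 2 - 1))
     = ln (\<Prod>k=1..n. (4 * real k ^ 2) / (4 * real k ^ 2 - 1))
       + ln (4 * real (Suc n) ^ 2 / ((2 * real n + 1) * (2 * real n + 3)))"
  proof -
    have "4 * real (Suc n) ^ 2 / ((2 * real n + 1) * (2 * real n + 3)) > 0" by simp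
    from ln_mult_pos[OF pos this] show ?thesis by (simp add: * del: of_nat_Suc)
  qed
  also have "ln (4 * real (Suc n) ^ 2 / ((2 * real n + 1) * (2 * real n + 3)))
     = 2 * ln 2 + 2 * ln (real n + 1) - ln (2 * real n + 1) - ln (2 * real n + 3)"
    using ln_realpow[of 2 2]
    by (simp add: ln_div ln_mult ln_realpow add_ac)
  finally have "ln (\<Prod>k=1..Suc n. (4 * real k ^ 2) / (4 * real k ^ 2 - 1))
     = ln (\<Prod>k=1..n. (4 * real k ^ 2) / (4 * real k ^ 2 - 1))
       + (2 * ln 2 + 2 * ln (real n + 1) - ln (2 * real n + 1) - ln (2 * real n + 3))" .
  moreover have "ln (fact (2 * Suc n) :: real) = ln 2 + ln (real n + 1) + ln (2 * real n + 1) + ln (fact (2 * n))"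
  proof -
    have "(fact (2 * Suc n) :: real) = 2 * (real n + 1) * (2 * real n + 1) * fact (2 * n)"
      by (simp add: algebra_simps)
    then show ?thesis by (simp only:) (simp add: ln_mult del: distrib_left_numeral)
  qed
  moreover have "ln (fact (Suc n) :: real) = ln (real n + 1) + ln (fact n)"
    by (simp add: ln_mult add_ac)
  ultimately show ?case
    unfolding Suc.IH by (simp add: algebra_simps)
qed simp

lemma ln_fact_tendsto:
  "(\<lambda>n. ln (fact n) - (real n + 1 / 2) * ln (real n) + real n) \<longlonglongrightarrow> ln (2 * pi) / 2"
proof -
  define a where "a = (\<lambda>n. ln (fact n) - (real n + 1 / 2) * ln (real n) + real n)"
  obtain c where c: "a \<longlonglongrightarrow> c"
    using convergent_ln_fact_error unfolding a_def convergent_def by blast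
  have "filterlim (\<lambda>n::nat. 2 * n) at_top at_top" by real_asymp
  then have "(\<lambda>n. a (2 * n)) \<longlonglongrightarrow> c" by (rule filterlim_compose[OF c])
  \<comment> \<open>In this combination the linear terms and those of size \<open>n ln n\<close>
    cancel. What remains is the logarithm of the Wallis product up to elementary terms, so
    \<open>2 * c\<close> is determined.\<close>
  then have lim1: "(\<lambda>n. 4 * a n - 2 * a (2 * n)) \<longlonglongrightarrow> 4 * c - 2 * c"
    by (intro tendsto_intros c)
  have "(\<lambda>n. ln (\<Prod>k=1..n. (4 * real k ^ 2) / (4 * real k ^ 2 - 1))) \<longlonglongrightarrow> ln (pi / 2)"
    by (intro tendsto_ln wallis) auto
  moreover have "(\<lambda>n. ln (2 * real n + 1) - ln (real n) + ln 2) \<longlonglongrightarrow> 2 * ln 2"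
    by real_asymp
  ultimately have lim2: "(\<lambda>n. ln (\<Prod>k=1..n. (4 * real k ^ 2) / (4 * real k ^ 2 - 1))
      + (ln (2 * real n + 1) - ln (real n) + ln 2)) \<longlonglongrightarrow> ln (pi / 2) + 2 * ln 2"
    by (rule tendsto_add)
  have "eventually (\<lambda>n. ln (\<Prod>k=1..n. (4 * real k ^ 2) / (4 * real k ^ 2 - 1))
      + (ln (2 * real n + 1) - ln (real n) + ln 2) = 4 * a n - 2 * a (2 * n)) at_top"
    using eventually_gt_at_top[of 0]
  proof eventually_elim
    case (elim n)
    then show ?case unfolding ln_wallis_prod by (simp add: a_def ln_mult field_simps)
  qed
  from tendsto_cong[THEN iffD1, OF this lim2] lim1
  have "4 * c - 2 * c = ln (pi / 2) + 2 * ln 2" by (rule LIMSEQ_unique[rotated])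
  then have "c = ln (2 * pi) / 2" by (simp add: ln_div ln_mult)
  then show ?thesis using c by (simp only: a_def)
qed

subsection \<open>The shifted Stirling expansion\<close>

text \<open>Approximates \<open>ln m! - (ln m)/2\<close> at \<open>m = z + t\<close>. The subtracted
  half logarithm is why \<open>ln z\<close> has the factor \<open>z + t\<close> and not
  \<open>z + t + 1/2\<close>; for \<open>t = 0\<close> the sum is the classical Stirling
  series.\<close>

definition stirling_approx :: "nat \<Rightarrow> real \<Rightarrow> real \<Rightarrow> real" where
  "stirling_approx M t z = (z + t) * ln z - z + ln (2 * pi) / 2 +
     (\<Sum>k=1..M. (-1) ^ (k + 1) * bernpoly_hat (k + 1) t / real (k * (k + 1)) * (1 / z ^ k))"

section \<open>The difference equation of the truncated expansion\<close>

text \<open>Equates the coefficients of \<open>w ^ n\<close>, \<open>w = 1 / z\<close>, in the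
  difference equation: the logarithms contribute the left side, the terms \<open>1 / z ^ k\<close>
  the right. All summands share the sign \<open>(-1) ^ (n + 1)\<close>, and the Bernoulli recurrence
  evaluates the rest.\<close>

lemma stirling_coeff_zero:
  fixes t :: real
  assumes "n \<ge> 1"
  shows "(-1) ^ (n + 1) / real n * (t ^ n + (t + 1) ^ n) / 2 - (-1) ^ (n + 2) / real (n + 1)
    - (1 + t) * ((-1) ^ (n + 1) / real n)
    = (\<Sum>k=1..<n. (-1) ^ (k + 1) * bernpoly_hat (k + 1) t / real (k * (k + 1)) *
        ((-1) ^ (n - k) * real (n - 1 choose (n - k))))"
proof -
  have "(\<Sum>k=1..<n. (-1) ^ (k + 1) * bernpoly_hat (k + 1) t / real (k * (k + 1)) *
        ((-1) ^ (n - k) * real (n - 1 choose (n - k))))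
      = (\<Sum>k=1..<n. (-1) ^ (n + 1) * (real (n - 1 choose (k - 1)) * bernpoly_hat (k + 1) t / real (k * (k + 1))))"
  proof (intro sum.cong refl)
    fix k assume k: "k \<in> {1..<n}"
    have "(n - 1 choose (n - k)) = (n - 1 choose (k - 1))"
    proof -
      have "k - 1 \<le> n - 1" "n - 1 - (k - 1) = n - k" using k by auto
      with binomial_symmetric[of "k - 1" "n - 1"] show ?thesis by simp
    qed
    moreover have "(-1) ^ (k + 1) * (-1) ^ (n - k) = ((-1) ^ (n + 1) :: real)"
      using k by (simp flip: power_add)
    moreover have "a * h / r * (b * x) = (a * b) * (x * h / r)" for a b h r x :: real
      by simp
    ultimately show "(-1) ^ (k + 1) * bernpoly_hat (k + 1) t / real (k * (k + 1)) *
        ((-1) ^ (n - k) * real (n - 1 choose (n - k)))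
      = (-1) ^ (n + 1) * (real (n - 1 choose (k - 1)) * bernpoly_hat (k + 1) t / real (k * (k + 1)))"
      by (simp only:)
  qed
  also have "\<dots> = (-1) ^ (n + 1) *
      ((t ^ n + (t + 1) ^ n) / (2 * real n) - (1 + real (n + 1) * t) / real (n * (n + 1)))"
    by (simp only: sum_distrib_left[symmetric] sum_choose_bernpoly_hat_interior[OF assms])
  also have "\<dots> = (-1) ^ (n + 1) / real n * (t ^ n + (t + 1) ^ n) / 2 - (-1) ^ (n + 2) / real (n + 1)
    - (1 + t) * ((-1) ^ (n + 1) / real n)"
  proof -
    have "s * (A / (2 * x) - (1 + (x + 1) * t) / (x * (x + 1)))
        = s / x * A / 2 - (- s) / (x + 1) - (1 + t) * (s / x)" if "x > 0" for s A x :: real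
    proof -
      have "(1 + (x + 1) * t) / (x * (x + 1)) = (1 + t) / x - 1 / (x + 1)"
        using that by (simp add: divide_simps) (simp add: algebra_simps)
      then show ?thesis by (simp only:) (simp add: right_diff_distrib mult.commute)
    qed
    from this[of "real n" "(-1) ^ (n + 1)" "t ^ n + (t + 1) ^ n"] show ?thesis
      using assms by (simp add: add_ac distrib_left)
  qed
  finally show ?thesis ..
qed

text \<open>The difference equation for \<open>stirling_approx\<close>, with every function of \<open>w = 1/z\<close> replaced by its Taylor polynomial.\<close>

lemma stirling_step_polynomial_zero:
  fixes z t :: real
  assumes "z \<noteq> 0"
  defines "w \<equiv> 1 / z"
  shows "((\<Sum>n\<le>M+1. (-1) ^ (n + 1) / real n * (t * w) ^ n)
        + (\<Sum>n\<le>M+1. (-1) ^ (n + 1) / real n * ((t + 1) * w) ^ n)) / 2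
      - z * (\<Sum>n\<le>M+2. (-1) ^ (n + 1) / real n * w ^ n)
      - (1 + t) * (\<Sum>n\<le>M+1. (-1) ^ (n + 1) / real n * w ^ n) + 1
      = (\<Sum>k=1..M. (-1) ^ (k + 1) * bernpoly_hat (k + 1) t / real (k * (k + 1)) *
          (w ^ k * ((\<Sum>j\<le>M+1-k. (-1) ^ j * real (k + j - 1 choose j) * w ^ j) - 1)))"
proof -
  define c where "c k = (-1) ^ (k + 1) * bernpoly_hat (k + 1) t / real (k * (k + 1))" for k
  define l where "l n = ((-1) ^ (n + 1) / real n :: real)" for n
  define s where "s k j = ((-1) ^ j * real (k + j - 1 choose j) :: real)" for k j
  have inner: "w ^ k * ((\<Sum>j\<le>M+1-k. s k j * w ^ j) - 1) = (\<Sum>n=k+1..M+1. s k (n - k) * w ^ n)"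
    if "k \<in> {1..M}" for k
  proof -
    have "{..M+1-k} = insert 0 {1..M+1-k}" by auto
    then have "(\<Sum>j\<le>M+1-k. s k j * w ^ j) - 1 = (\<Sum>j=1..M+1-k. s k j * w ^ j)"
      by (simp add: s_def)
    also have "w ^ k * \<dots> = (\<Sum>j=1..M+1-k. s k j * w ^ (j + k))"
      by (simp add: sum_distrib_left power_add mult_ac)
    also have "\<dots> = (\<Sum>n=1+k..M+1-k+k. s k (n - k) * w ^ n)"
      by (subst sum.shift_bounds_cl_nat_ivl) simp
    finally show ?thesis using that by simp
  qed
  have "(\<Sum>k=1..M. c k * (w ^ k * ((\<Sum>j\<le>M+1-k. s k j * w ^ j) - 1)))
      = (\<Sum>k=1..M. \<Sum>n=k+1..M+1. c k * s k (n - k) * w ^ n)"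
    by (intro sum.cong refl) (simp only: inner sum_distrib_left mult.assoc)
  \<comment> \<open>Regroup by total degree \<open>n\<close>. Since \<open>n\<close> stops at
    \<open>M + 1\<close>, the condition \<open>k < n\<close> already forces \<open>k\<close> to be
    at most \<open>M\<close>.\<close>
  also have "\<dots> = (\<Sum>n\<le>M+1. \<Sum>k=1..<n. c k * s k (n - k) * w ^ n)"
    unfolding sum.Sigma[OF finite_atLeastAtMost ballI[OF finite_atLeastAtMost]]
      sum.Sigma[OF finite_atMost ballI[OF finite_atLeastLessThan]]
    by (rule sum.reindex_bij_witness[of _ "\<lambda>(n,k). (k,n)" "\<lambda>(k,n). (n,k)"]) auto
  also have "\<dots> = (\<Sum>n\<le>M+1. (\<Sum>k=1..<n. c k * s k (n - k)) * w ^ n)"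
    by (simp only: sum_distrib_right)
  \<comment> \<open>At \<open>n = 0\<close> the bracket is -1, because \<open>l 0 = 0\<close>
    (division by zero) and \<open>l 1 = 1\<close>. The added 1 compensates and becomes the constant
    in the claim.\<close>
  also have "\<dots> = (\<Sum>n\<le>M+1. (l n * (t ^ n + (t + 1) ^ n) / 2 - l (n + 1) - (1 + t) * l n) * w ^ n
      + (if n = 0 then 1 else 0))"
  proof (intro sum.cong refl)
    fix n assume "n \<in> {..M+1}"
    show "(\<Sum>k=1..<n. c k * s k (n - k)) * w ^ n =
       (l n * (t ^ n + (t + 1) ^ n) / 2 - l (n + 1) - (1 + t) * l n) * w ^ n + (if n = 0 then 1 else 0)"
    proof (cases "n = 0")
      case False
      then have "(\<Sum>k=1..<n. c k * s k (n - k)) = l n * (t ^ n + (t + 1) ^ n) / 2 - l (n + 1) - (1 + t) * l n"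
        using stirling_coeff_zero[of n t] by (simp add: c_def s_def l_def)
      then show ?thesis using False by simp
    qed (simp add: l_def)
  qed
  also have "\<dots> = ((\<Sum>n\<le>M+1. l n * (t * w) ^ n) + (\<Sum>n\<le>M+1. l n * ((t + 1) * w) ^ n)) / 2
      - (\<Sum>n\<le>M+1. l (n + 1) * w ^ n) - (1 + t) * (\<Sum>n\<le>M+1. l n * w ^ n) + 1"
  proof -
    have "(l n * (t ^ n + (t + 1) ^ n) / 2 - l (n + 1) - (1 + t) * l n) * w ^ n
      = (l n * (t * w) ^ n + l n * ((t + 1) * w) ^ n) / 2 - l (n + 1) * w ^ n - (1 + t) * (l n * w ^ n)" for n
      unfolding power_mult_distrib by (simp add: field_simps)
    then show ?thesis
      by (simp only: sum.distrib sum_subtractf sum_divide_distrib[symmetric] sum_distrib_left[symmetric]) simp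
  qed
  \<comment> \<open>The factor \<open>z\<close> costs one power of \<open>w\<close>, hence the
    truncation at \<open>M + 2\<close>; the term \<open>n = 0\<close> vanishes.\<close>
  also have "(\<Sum>n\<le>M+1. l (n + 1) * w ^ n) = z * (\<Sum>n\<le>M+2. l n * w ^ n)"
  proof -
    have "(\<Sum>n\<le>Suc (M+1). l n * w ^ n) = (\<Sum>n\<le>M+1. l (Suc n) * w ^ Suc n)"
      by (subst sum.atMost_Suc_shift) (simp add: l_def)
    also have "z * \<dots> = (\<Sum>n\<le>M+1. l (n + 1) * w ^ n)"
      unfolding sum_distrib_left using assms by (intro sum.cong refl) (simp add: w_def)
    finally show ?thesis by simp
  qed
  finally show ?thesis by (simp only: c_def s_def l_def)
qed

text \<open>Replacing each function of \<open>1 / z\<close> by its Taylor polynomial makes the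
  expression vanish by \<open>stirling_step_polynomial_zero\<close>. Only remainders of order
  \<open>M + 2\<close> survive, uniformly in \<open>t\<close>.\<close>

lemma stirling_step:
  fixes R :: real
  shows "\<exists>C Z. \<forall>z t. z \<ge> Z \<longrightarrow> \<bar>t\<bar> \<le> R \<longrightarrow>
    \<bar>(ln (z + t) + ln (z + t + 1)) / 2 - (stirling_approx M t (z + 1) - stirling_approx M t z)\<bar>
      \<le> C / z ^ (M + 2)"
proof -
  \<comment> \<open>Landau symbols along this product filter express estimates for large
    \<open>z\<close> that are uniform in \<open>t\<close> on \<open>{-R..R}\<close>.\<close>
  define F :: "(real \<times> real) filter" where "F = at_top \<times>\<^sub>F principal {-R..R}"
  define w where "w p = 1 / fst p" for p :: "real \<times> real"
  define l where "l n = ((-1) ^ (n + 1) / real n :: real)" for n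
  define s where "s k j = ((-1) ^ j * real (k + j - 1 choose j) :: real)" for k j
  define c where "c t k = (-1) ^ (k + 1) * bernpoly_hat (k + 1) t / real (k * (k + 1))" for t k
  have F1: "filterlim fst at_top F" and F2: "filterlim snd (principal {-R..R}) F"
    unfolding F_def by (rule filterlim_fst, rule filterlim_snd)
  have w0: "(w \<longlongrightarrow> 0) F"
    unfolding w_def by (rule filterlim_compose[OF _ F1]) real_asymp
  have bounded: "(\<lambda>p. f (snd p)) \<in> O[F](\<lambda>_. 1)" if "continuous_on {-R..R} f" for f :: "real \<Rightarrow> real"
  proof -
    have "compact (f ` {-R..R})" using that by (rule compact_continuous_image) simp
    then obtain B where B: "\<And>x. x \<in> {-R..R} \<Longrightarrow> \<bar>f x\<bar> \<le> B"
      by (metis compact_imp_bounded bounded_iff imageI real_norm_def)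
    have "eventually (\<lambda>x. \<bar>f x\<bar> \<le> B) (principal {-R..R})"
      using B by (simp add: eventually_principal)
    then have "eventually (\<lambda>p. \<bar>f (snd p)\<bar> \<le> B) F"
      using F2 by (rule eventually_compose_filterlim)
    then show ?thesis by (intro bigoI[of _ B]) simp
  qed
  have ln_rem: "(\<lambda>p. ln (1 + f (snd p) * w p) - (\<Sum>n\<le>L. l n * (f (snd p) * w p) ^ n)) \<in> O[F](\<lambda>p. w p ^ (L + 1))"
    if "continuous_on {-R..R} f" for f L
  proof -
    have O: "(\<lambda>p. f (snd p) * w p) \<in> O[F](w)"
      using landau_o.big.mult[OF bounded[OF that] landau_o.big_refl[of w]] by simp
    have "w \<in> o[F](\<lambda>_. 1)" using w0 by (intro smalloI_tendsto) auto
    with O have "(\<lambda>p. f (snd p) * w p) \<in> o[F](\<lambda>_. 1)" by (rule landau_o.big_small_trans)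
    then have "((\<lambda>p. f (snd p) * w p) \<longlongrightarrow> 0) F" using smalloD_tendsto by force
    from landau_o.big.compose[OF ln_remainder_bigo[of L] this]
    have "(\<lambda>p. ln (1 + f (snd p) * w p) - (\<Sum>n\<le>L. l n * (f (snd p) * w p) ^ n))
        \<in> O[F](\<lambda>p. (f (snd p) * w p) ^ (L + 1))"
      by (simp only: l_def)
    also have "(\<lambda>p. (f (snd p) * w p) ^ (L + 1)) \<in> O[F](\<lambda>p. w p ^ (L + 1))"
      using O by (rule landau_o.big_power)
    finally show ?thesis .
  qed
  \<comment> \<open>The Taylor remainders: \<open>f1\<close> and \<open>f2\<close> belong to the two
    averaged logarithms, \<open>f3\<close> and \<open>f4\<close> to the parts \<open>z\<close> and
    \<open>1 + t\<close> of the factor of \<open>ln (1 + w)\<close>, and \<open>g k\<close> to the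
    \<open>k\<close>-th correction term. The factor \<open>z\<close> in \<open>f3\<close> is paid
    for by one extra degree.\<close>
  define f1 where "f1 p = ln (1 + snd p * w p) - (\<Sum>n\<le>M+1. l n * (snd p * w p) ^ n)" for p
  define f2 where "f2 p = ln (1 + (snd p + 1) * w p) - (\<Sum>n\<le>M+1. l n * ((snd p + 1) * w p) ^ n)" for p
  define f3 where "f3 p = fst p * (ln (1 + w p) - (\<Sum>n\<le>M+2. l n * w p ^ n))" for p
  define f4 where "f4 p = (1 + snd p) * (ln (1 + w p) - (\<Sum>n\<le>M+1. l n * w p ^ n))" for p
  define g where "g k p = c (snd p) k * (w p ^ k * (1 / (1 + w p) ^ k - (\<Sum>j\<le>M+1-k. s k j * w p ^ j)))" for k p
  have f1: "f1 \<in> O[F](\<lambda>p. w p ^ (M + 2))"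
    using ln_rem[of "\<lambda>x. x" "M + 1"] unfolding f1_def[abs_def] by simp
  have f2: "f2 \<in> O[F](\<lambda>p. w p ^ (M + 2))"
    using ln_rem[of "\<lambda>x. x + 1" "M + 1"] unfolding f2_def[abs_def] by (simp add: continuous_intros)
  have f3: "f3 \<in> O[F](\<lambda>p. w p ^ (M + 2))"
  proof -
    have "f3 \<in> O[F](\<lambda>p. fst p * w p ^ (M + 3))"
      using landau_o.big.mult[OF landau_o.big_refl[of fst] ln_rem[of "\<lambda>_. 1" "M + 2"]]
      unfolding f3_def[abs_def] by (simp add: numeral_3_eq_3)
    also have "eventually (\<lambda>p. fst p * w p ^ (M + 3) = w p ^ (M + 2)) F"
      using filterlim_at_top_dense[THEN iffD1, OF F1, rule_format, of 0]
      by eventually_elim (simp add: w_def power_add numeral_3_eq_3)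
    then have "(\<lambda>p. fst p * w p ^ (M + 3)) \<in> \<Theta>[F](\<lambda>p. w p ^ (M + 2))"
      by (rule bigthetaI_cong)
    finally show ?thesis .
  qed
  have f4: "f4 \<in> O[F](\<lambda>p. w p ^ (M + 2))"
    using landau_o.big.mult[OF bounded[of "\<lambda>x. 1 + x"] ln_rem[of "\<lambda>_. 1" "M + 1"]]
    unfolding f4_def[abs_def] by (simp add: continuous_intros)
  have g: "g k \<in> O[F](\<lambda>p. w p ^ (M + 2))" if k: "k \<in> {1..M}" for k
  proof -
    have "real (k * (k + 1)) \<noteq> 0" using k by (simp only: of_nat_eq_0_iff) simp
    then have "(\<lambda>p. c (snd p) k) \<in> O[F](\<lambda>_. 1)"
      unfolding c_def by (intro bounded continuous_intros continuous_on_bernpoly_hat) blast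
    moreover have "(\<lambda>p. 1 / (1 + w p) ^ k - (\<Sum>j\<le>M+1-k. s k j * w p ^ j)) \<in> O[F](\<lambda>p. w p ^ (M + 1 - k + 1))"
      using landau_o.big.compose[OF inverse_power_remainder_bigo[of k "M + 1 - k"] w0] k
      by (simp add: s_def)
    ultimately have "g k \<in> O[F](\<lambda>p. 1 * (w p ^ k * w p ^ (M + 1 - k + 1)))"
      unfolding g_def[abs_def] by (intro landau_o.big.mult landau_o.big_refl)
    moreover have "(\<lambda>p. 1 * (w p ^ k * w p ^ (M + 1 - k + 1))) = (\<lambda>p. w p ^ (M + 2))"
      using k by (simp only: power_add[symmetric] mult_1) simp
    ultimately show ?thesis by (simp only:)
  qed
  have "(\<lambda>p. f1 p / 2 + f2 p / 2 - f3 p - f4 p - (\<Sum>k=1..M. g k p)) \<in> O[F](\<lambda>p. w p ^ (M + 2))"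
    by (intro sum_in_bigo big_sum_in_bigo g f3 f4) (use f1 f2 in auto)
  then obtain C where C: "eventually (\<lambda>p. norm (f1 p / 2 + f2 p / 2 - f3 p - f4 p - (\<Sum>k=1..M. g k p))
      \<le> C * norm (w p ^ (M + 2))) F"
    by (elim landau_o.bigE)
  then obtain P Q where P: "eventually P at_top" and Q: "eventually Q (principal {-R..R})"
    and PQ: "\<And>z t. P z \<Longrightarrow> Q t \<Longrightarrow> \<bar>f1 (z, t) / 2 + f2 (z, t) / 2 - f3 (z, t) - f4 (z, t) - (\<Sum>k=1..M. g k (z, t))\<bar>
      \<le> C * \<bar>w (z, t) ^ (M + 2)\<bar>"
    unfolding F_def eventually_prod_filter real_norm_def by blast
  from P obtain Z where Z: "\<And>z. z \<ge> Z \<Longrightarrow> P z" by (auto simp: eventually_at_top_linorder)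
  \<comment> \<open>The threshold \<open>\<bar>R\<bar> + 2\<close> keeps \<open>z + t\<close>
    positive, so that all logarithms have positive arguments.\<close>
  show ?thesis
  proof (rule exI[of _ C], rule exI[of _ "max Z (\<bar>R\<bar> + 2)"], intro allI impI)
    fix z t assume z: "max Z (\<bar>R\<bar> + 2) \<le> z" and t: "\<bar>t\<bar> \<le> R"
    define v where "v = w (z, t)"
    have v: "v = 1 / z" by (simp add: v_def w_def)
    have pos: "z > 0" "z + t > 0" "z + t + 1 > 0" using z t by auto
    \<comment> \<open>Each logarithm is split as \<open>ln z\<close> plus a function of
      \<open>v = 1 / z\<close>; the multiples of \<open>ln z\<close> cancel in the
      increment.\<close>
    have e1: "ln (z + t) = ln z + ln (1 + t * v)"
    proof -
      have "z + t = z * (1 + t * v)" using pos by (simp add: v field_simps)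
      moreover have "1 + t * v > 0" using pos by (simp add: v field_simps)
      ultimately show ?thesis using pos by (simp add: ln_mult_pos)
    qed
    have e2: "ln (z + t + 1) = ln z + ln (1 + (t + 1) * v)"
    proof -
      have "z + t + 1 = z * (1 + (t + 1) * v)" using pos by (simp add: v field_simps)
      moreover have "1 + (t + 1) * v > 0" using pos by (simp add: v field_simps)
      ultimately show ?thesis using pos by (metis ln_mult_pos)
    qed
    have e3: "ln (z + 1) = ln z + ln (1 + v)"
    proof -
      have "z + 1 = z * (1 + v)" using pos by (simp add: v field_simps)
      moreover have "1 + v > 0" using pos by (simp add: v field_simps)
      ultimately show ?thesis using pos by (metis ln_mult_pos)
    qed
    have e4: "1 / (z + 1) ^ k - 1 / z ^ k = v ^ k * (1 / (1 + v) ^ k - 1)" for k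
    proof -
      have "1 / (z + 1) = v * (1 / (1 + v))" using pos by (simp add: v field_simps)
      then have "(1 / (z + 1)) ^ k = v ^ k * (1 / (1 + v)) ^ k" by (metis power_mult_distrib)
      then show ?thesis by (simp add: v power_one_over algebra_simps)
    qed
    have sumdiff: "(\<Sum>k=1..M. c t k * (1 / (z + 1) ^ k)) - (\<Sum>k=1..M. c t k * (1 / z ^ k))
        = (\<Sum>k=1..M. c t k * (v ^ k * (1 / (1 + v) ^ k - 1)))"
      unfolding sum_subtractf[symmetric] right_diff_distrib[symmetric] e4 ..
    have sumg: "(\<Sum>k=1..M. c t k * (v ^ k * (1 / (1 + v) ^ k - 1)))
        = (\<Sum>k=1..M. g k (z, t)) + (\<Sum>k=1..M. c t k * (v ^ k * ((\<Sum>j\<le>M+1-k. s k j * v ^ j) - 1)))"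
    proof -
      have "a * (b * (x - y)) + a * (b * (y - 1)) = a * (b * (x - 1))" for a b x y :: real
        by (simp add: algebra_simps)
      then show ?thesis unfolding sum.distrib[symmetric] g_def v_def[symmetric] snd_conv by simp
    qed
    have poly: "((\<Sum>n\<le>M+1. l n * (t * v) ^ n) + (\<Sum>n\<le>M+1. l n * ((t + 1) * v) ^ n)) / 2
      - z * (\<Sum>n\<le>M+2. l n * v ^ n) - (1 + t) * (\<Sum>n\<le>M+1. l n * v ^ n) + 1
      = (\<Sum>k=1..M. c t k * (v ^ k * ((\<Sum>j\<le>M+1-k. s k j * v ^ j) - 1)))"
      using stirling_step_polynomial_zero[of z t M] pos unfolding l_def c_def s_def v by simp
    have "(ln (z + t) + ln (z + t + 1)) / 2 - (stirling_approx M t (z + 1) - stirling_approx M t z)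
      = (ln (z + t) + ln (z + t + 1)) / 2 - (z + 1 + t) * ln (z + 1) + (z + t) * ln z + 1
        - ((\<Sum>k=1..M. c t k * (1 / (z + 1) ^ k)) - (\<Sum>k=1..M. c t k * (1 / z ^ k)))"
      by (simp add: stirling_approx_def c_def)
    also have "\<dots> = (ln (1 + t * v) + ln (1 + (t + 1) * v)) / 2 - z * ln (1 + v) - (1 + t) * ln (1 + v) + 1
        - ((\<Sum>k=1..M. c t k * (1 / (z + 1) ^ k)) - (\<Sum>k=1..M. c t k * (1 / z ^ k)))"
      unfolding e1 e2 e3 by (simp add: algebra_simps add_divide_distrib)
    also have "\<dots> = f1 (z, t) / 2 + f2 (z, t) / 2 - f3 (z, t) - f4 (z, t) - (\<Sum>k=1..M. g k (z, t))"
    proof -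
      \<comment> \<open>Rewriting the polynomial sum by \<open>poly\<close> pairs each function with
        its own Taylor polynomial.\<close>
      have "(a + b) / 2 - z * x - (1 + t) * x + 1 - (G + ((p1 + p2) / 2 - z * p3 - (1 + t) * p4 + 1))
        = (a - p1) / 2 + (b - p2) / 2 - z * (x - p3) - (1 + t) * (x - p4) - G" for a b x G p1 p2 p3 p4
        by (simp add: field_simps)
      then show ?thesis
        unfolding sumdiff sumg poly[symmetric] f1_def f2_def f3_def f4_def fst_conv snd_conv v_def[symmetric] .
    qed
    finally have eq: "(ln (z + t) + ln (z + t + 1)) / 2 - (stirling_approx M t (z + 1) - stirling_approx M t z)
      = f1 (z, t) / 2 + f2 (z, t) / 2 - f3 (z, t) - f4 (z, t) - (\<Sum>k=1..M. g k (z, t))" .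
    have "\<bar>f1 (z, t) / 2 + f2 (z, t) / 2 - f3 (z, t) - f4 (z, t) - (\<Sum>k=1..M. g k (z, t))\<bar>
        \<le> C * \<bar>w (z, t) ^ (M + 2)\<bar>"
      using z t Q by (intro PQ Z) (auto simp: eventually_principal abs_le_iff)
    also have "\<dots> = C / z ^ (M + 2)"
      using pos by (simp add: w_def power_one_over)
    finally show "\<bar>(ln (z + t) + ln (z + t + 1)) / 2 - (stirling_approx M t (z + 1) - stirling_approx M t z)\<bar>
      \<le> C / z ^ (M + 2)"
      unfolding eq .
  qed
qed

section \<open>Summing the difference equation to infinity\<close>

text \<open>Bounds the sum of the step errors by a telescoping sum. The factor
  \<open>2 ^ (s + 1)\<close> comes from \<open>x + 1 \<le> 2 * x\<close>.\<close>

lemma inverse_power_le_telescope: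
  fixes x :: real
  assumes "x \<ge> 1"
  shows "1 / x ^ (s + 2) \<le> 2 ^ (s + 1) * (1 / x ^ (s + 1) - 1 / (x + 1) ^ (s + 1))"
proof -
  have "x ^ s \<le> (x + 1) ^ s" using assms by (intro power_mono) auto
  then have "(x + 1) * x ^ s \<le> (x + 1) * (x + 1) ^ s" using assms by (intro mult_left_mono) auto
  then have *: "x ^ s \<le> (x + 1) ^ (s + 1) - x ^ (s + 1)" by (simp add: algebra_simps)
  have "(x + 1) ^ (s + 1) \<le> (2 * x) ^ (s + 1)" using assms by (intro power_mono) auto
  then have "1 / (2 * x) ^ (s + 1) \<le> 1 / (x + 1) ^ (s + 1)"
    using assms by (intro divide_left_mono mult_pos_pos zero_less_power) auto
  then have "1 / x * (1 / (2 * x) ^ (s + 1)) \<le> 1 / x * (1 / (x + 1) ^ (s + 1))"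
    using assms by (intro mult_left_mono) auto
  also have "\<dots> = x ^ s / (x ^ (s + 1) * (x + 1) ^ (s + 1))"
    using assms by simp
  also have "\<dots> \<le> ((x + 1) ^ (s + 1) - x ^ (s + 1)) / (x ^ (s + 1) * (x + 1) ^ (s + 1))"
    using * assms by (intro divide_right_mono mult_nonneg_nonneg zero_le_power) auto
  also have "\<dots> = 1 / x ^ (s + 1) - 1 / (x + 1) ^ (s + 1)"
    using assms by (simp add: diff_divide_distrib del: power_Suc)
  finally have "2 ^ (s + 1) * (1 / x * (1 / (2 * x) ^ (s + 1)))
      \<le> 2 ^ (s + 1) * (1 / x ^ (s + 1) - 1 / (x + 1) ^ (s + 1))"
    by (intro mult_left_mono) auto
  also have "2 ^ (s + 1) * (1 / x * (1 / (2 * x) ^ (s + 1))) = 1 / x ^ (s + 2)"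
    by (simp add: power_mult_distrib)
  finally show ?thesis .
qed

text \<open>The boundary value at infinity for the telescoping: \<open>m\<close> and
  \<open>z\<close> move together while \<open>t\<close> stays fixed. Stirling's formula supplies the
  constant, and the correction terms vanish in the limit.\<close>

lemma stirling_error_tendsto:
  fixes z t :: real
  assumes "real m = z + t"
  shows "(\<lambda>n. ln (fact (m + n)) - ln (real (m + n)) / 2 - stirling_approx M t (z + real n)) \<longlonglongrightarrow> 0"
proof -
  define c where "c k = (-1) ^ (k + 1) * bernpoly_hat (k + 1) t / real (k * (k + 1))" for k
  have zn: "filterlim (\<lambda>n. z + real n) at_top at_top" by real_asymp
  have "(\<lambda>n. ln (fact (n + m)) - (real (n + m) + 1 / 2) * ln (real (n + m)) + real (n + m))
      \<longlonglongrightarrow> ln (2 * pi) / 2"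
    by (rule LIMSEQ_ignore_initial_segment[OF ln_fact_tendsto])
  \<comment> \<open>This limit accounts for expanding around \<open>z\<close> instead of
    \<open>m = z + t\<close>.\<close>
  moreover have "((\<lambda>x. (x + t) * (ln (x + t) - ln x) - t) \<longlongrightarrow> 0) at_top"
    by real_asymp
  then have "(\<lambda>n. (z + real n + t) * (ln (z + real n + t) - ln (z + real n)) - t) \<longlonglongrightarrow> 0"
    by (rule filterlim_compose[OF _ zn])
  moreover have "(\<lambda>n. \<Sum>k=1..M. c k * (1 / (z + real n) ^ k)) \<longlonglongrightarrow> 0"
  proof (intro tendsto_null_sum tendsto_mult_right_zero)
    fix k assume "k \<in> {1..M}"
    then have "((\<lambda>x::real. 1 / x ^ k) \<longlongrightarrow> 0) at_top"
      by (intro tendsto_divide_0[OF tendsto_const] filterlim_at_top_imp_at_infinity filterlim_pow_at_top filterlim_ident) auto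
    then show "(\<lambda>n. 1 / (z + real n) ^ k) \<longlonglongrightarrow> 0"
      by (rule filterlim_compose[OF _ zn])
  qed
  ultimately have "(\<lambda>n. (ln (fact (n + m)) - (real (n + m) + 1 / 2) * ln (real (n + m)) + real (n + m))
      + ((z + real n + t) * (ln (z + real n + t) - ln (z + real n)) - t)
      - ln (2 * pi) / 2 - (\<Sum>k=1..M. c k * (1 / (z + real n) ^ k))) \<longlonglongrightarrow> ln (2 * pi) / 2 + 0 - ln (2 * pi) / 2 - 0"
    by (intro tendsto_intros)
  moreover have "(ln (fact (n + m)) - (real (n + m) + 1 / 2) * ln (real (n + m)) + real (n + m))
      + ((z + real n + t) * (ln (z + real n + t) - ln (z + real n)) - t)
      - ln (2 * pi) / 2 - (\<Sum>k=1..M. c k * (1 / (z + real n) ^ k))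
    = ln (fact (m + n)) - ln (real (m + n)) / 2 - stirling_approx M t (z + real n)" for n
  proof -
    have e: "real (n + m) = z + real n + t" "real (m + n) = z + real n + t" using assms by simp_all
    show ?thesis
      unfolding stirling_approx_def c_def[symmetric] e add.commute[of m n] by (simp add: algebra_simps)
  qed
  ultimately show ?thesis by simp
qed

text \<open>The error \<open>G n\<close> at \<open>(m + n, z + n)\<close> tends to 0, and its
  increments are controlled by \<open>stirling_step\<close>. Hence \<open>G 0\<close> is at most the
  sum of all increment bounds.\<close>

lemma ln_fact_stirling:
  fixes R :: real
  shows "\<exists>C\<ge>0. \<exists>Z. \<forall>z t m. z \<ge> Z \<longrightarrow> \<bar>t\<bar> \<le> R \<longrightarrow> real m = z + t \<longrightarrow>
    \<bar>ln (fact m) - ln (real m) / 2 - stirling_approx M t z\<bar> \<le> C / z ^ (M + 1)"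
proof -
  obtain C Z where step: "\<And>z t. z \<ge> Z \<Longrightarrow> \<bar>t\<bar> \<le> R \<Longrightarrow>
    \<bar>(ln (z + t) + ln (z + t + 1)) / 2 - (stirling_approx M t (z + 1) - stirling_approx M t z)\<bar>
      \<le> C / z ^ (M + 2)"
    using stirling_step[of R M] by blast
  \<comment> \<open>The absolute value is taken because \<open>C\<close> has no known sign; the
    power of 2 comes from the telescoping bound.\<close>
  define B where "B = \<bar>C\<bar> * 2 ^ (M + 1)"
  show ?thesis
  proof (rule exI[of _ B], rule conjI, simp add: B_def,
      rule exI[of _ "max Z (\<bar>R\<bar> + 1)"], intro allI impI)
    fix z t m assume z: "max Z (\<bar>R\<bar> + 1) \<le> z" and t: "\<bar>t\<bar> \<le> R" and m: "real m = z + t"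
    define G where "G n = ln (fact (m + n)) - ln (real (m + n)) / 2 - stirling_approx M t (z + real n)" for n
    have G: "G \<longlonglongrightarrow> 0"
      unfolding G_def[abs_def] by (rule stirling_error_tendsto[OF m])
    have "real m > 0" using m z t by auto
    have diff: "\<bar>G (Suc n) - G n\<bar> \<le> B * (1 / (z + real n) ^ (M + 1) - 1 / (z + real (Suc n)) ^ (M + 1))" for n
    proof -
      have "ln (fact (m + Suc n)) = ln (fact (m + n) :: real) + ln (real (m + n) + 1)"
        using ln_mult_pos[of "real (m + n) + 1" "fact (m + n)"] by (simp add: add_ac)
      \<comment> \<open>Subtracting half a logarithm turns the increment
        \<open>ln (m + n + 1)\<close> of \<open>ln (fact (m + n))\<close> into the average of two
        logarithms required by \<open>step\<close>.\<close>
      then have "G (Suc n) - G n = (ln (real (m + n)) + ln (real (m + n) + 1)) / 2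
          - (stirling_approx M t (z + real n + 1) - stirling_approx M t (z + real n))"
        by (simp add: G_def algebra_simps del: fact_Suc)
      also have "real (m + n) = z + real n + t" using m by simp
      also have "\<bar>(ln (z + real n + t) + ln (z + real n + t + 1)) / 2
          - (stirling_approx M t (z + real n + 1) - stirling_approx M t (z + real n))\<bar> \<le> C / (z + real n) ^ (M + 2)"
        using z t by (intro step) auto
      also have "\<dots> \<le> \<bar>C\<bar> * (1 / (z + real n) ^ (M + 2))"
      proof -
        have "C / y \<le> \<bar>C\<bar> * (1 / y)" if "y > 0" for y
          using that by (simp add: divide_right_mono)
        then show ?thesis using z by (auto intro!: zero_less_power)
      qed
      also have "\<dots> \<le> \<bar>C\<bar> * (2 ^ (M + 1) * (1 / (z + real n) ^ (M + 1) - 1 / (z + real n + 1) ^ (M + 1)))"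
        using z by (intro mult_left_mono inverse_power_le_telescope) auto
      finally show ?thesis by (simp add: B_def add_ac mult.assoc)
    qed
    have bound: "\<bar>G n - G 0\<bar> \<le> B * (1 / z ^ (M + 1) - 1 / (z + real n) ^ (M + 1))" for n
    proof (induction n)
      case (Suc n)
      have "\<bar>G (Suc n) - G 0\<bar> \<le> \<bar>G (Suc n) - G n\<bar> + \<bar>G n - G 0\<bar>" by simp
      also have "\<dots> \<le> B * (1 / (z + real n) ^ (M + 1) - 1 / (z + real (Suc n)) ^ (M + 1))
          + B * (1 / z ^ (M + 1) - 1 / (z + real n) ^ (M + 1))"
        by (intro add_mono diff Suc.IH)
      finally show ?case by (simp only: right_diff_distrib)
    qed simp
    have "\<bar>G n - G 0\<bar> \<le> B / z ^ (M + 1)" for n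
    proof -
      have "B * (1 / (z + real n) ^ (M + 1)) \<ge> 0"
        using z by (intro mult_nonneg_nonneg divide_nonneg_nonneg zero_le_power) (auto simp: B_def)
      with bound[of n] show ?thesis by (simp add: right_diff_distrib)
    qed
    then have "\<bar>0 - G 0\<bar> \<le> B / z ^ (M + 1)"
      by (intro LIMSEQ_le_const2[OF tendsto_rabs[OF tendsto_diff[OF G tendsto_const]]]) auto
    then show "\<bar>ln (fact m) - ln (real m) / 2 - stirling_approx M t z\<bar> \<le> B / z ^ (M + 1)"
      by (simp add: G_def)
  qed
qed

subsection \<open>The binomial mass\<close>

text \<open>Splits the coefficient into the contributions of \<open>N!\<close>, \<open>m!\<close>
  and \<open>(N - m)!\<close>. The parity of \<open>bernpoly_hat\<close> cancels the sign in the
  last one, which explains the asymmetric signs in \<open>Xi\<close>.\<close>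

lemma A_hat_eq:
  assumes "k \<ge> 1"
  shows "A_hat k t p / N ^ k =
      (-1) ^ (k + 1) * bernpoly_hat (k + 1) 0 / real (k * (k + 1)) * (1 / N ^ k)
    - (-1) ^ (k + 1) * bernpoly_hat (k + 1) t / real (k * (k + 1)) * (1 / (N * p) ^ k)
    - (-1) ^ (k + 1) * bernpoly_hat (k + 1) (- t) / real (k * (k + 1)) * (1 / (N * (1 - p)) ^ k)"
proof -
  have "bernpoly_hat (k + 1) (- t) = (-1) ^ (k + 1) * bernpoly_hat (k + 1) t"
    by (rule bernpoly_hat_minus)
  moreover have "bernpoly_hat (k + 1) 0 = bernoulli (k + 1)"
    using bernpoly_hat_at_0[OF assms] by simp
  moreover have "(s * b - (s / x + 1 / y) * h) / r / n
      = s * b / r * (1 / n) - s * h / r * (1 / (n * x)) - s * (s * h) / r * (1 / (n * y))"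
    if "s * s = 1" for s b x y h r n :: real
  proof -
    have "s * (s * h) = h" using that by (simp flip: mult.assoc)
    then show ?thesis
      by (simp only:) (simp only: divide_inverse inverse_mult_distrib mult_1_left algebra_simps)
  qed
  moreover have "(-1) ^ (k + 1) * (-1) ^ (k + 1) = (1::real)"
    by (simp flip: power_mult_distrib)
  ultimately show ?thesis
    unfolding A_hat_def Xi_def power_mult_distrib by (simp only:)
qed

text \<open>Under the exchange both \<open>Xi\<close> and \<open>bernpoly_hat\<close> acquire the
  factor \<open>(-1) ^ (k + 1)\<close>, so their product is unchanged.\<close>

lemma A_hat_symmetric: "A_hat k (- t) (1 - p) = A_hat k t p"
proof -
  have "bernpoly_hat (k + 1) (- t) = (-1) ^ (k + 1) * bernpoly_hat (k + 1) t"
    by (rule bernpoly_hat_minus)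
  moreover have "Xi k (1 - p) = (-1) ^ (k + 1) * Xi k p"
  proof -
    have "s * (s / x + 1 / y) = s / y + 1 / x" if "s * s = 1" for s x y :: real
      using that by (simp add: distrib_left)
    from this[of "(-1) ^ (k + 1)"] show ?thesis
      by (simp add: Xi_def flip: power_mult_distrib)
  qed
  moreover have "((-1) ^ (k + 1) * x) * ((-1) ^ (k + 1) * y) = x * y" for x y :: real
    by (simp flip: power_mult_distrib)
  ultimately show ?thesis
    by (simp only: A_hat_def)
qed

lemma A_hat_eq_A_tilde:
  assumes "k \<ge> 1"
  shows "A_hat k t p = A_tilde k t p - Xi k p * t ^ k / (2 * real k)"
proof -
  have "bernpoly_hat (k + 1) t = bernpoly (k + 1) t + real (k + 1) * t ^ k / 2"
    using bernpoly_hat_eq[of k t] by simp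
  moreover have "(a - x * (b + (r + 1) * u / 2)) / (r * (r + 1)) = (a - x * b) / (r * (r + 1)) - x * u / (2 * r)"
    if "r > 0" for a x b r u :: real
  proof -
    have "x * u / (2 * r) = x * ((r + 1) * u / 2) / (r * (r + 1))"
      using that by (simp add: divide_simps)
    then show ?thesis by (simp add: distrib_left diff_divide_distrib add_divide_distrib)
  qed
  from this[of "real k"] have "(a - x * (b + real (k + 1) * u / 2)) / real (k * (k + 1))
      = (a - x * b) / real (k * (k + 1)) - x * u / (2 * real k)" for a x b u
    using assms by (simp add: add_ac distrib_left)
  ultimately show ?thesis
    by (simp only: A_hat_def A_tilde_def)
qed

text \<open>An exact identity. The terms with \<open>ln p\<close>, \<open>ln (1 - p)\<close> and the
  linear terms cancel, because \<open>N p + N (1 - p) = N\<close> and the shifts \<open>t\<close>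
  and \<open>-t\<close> are opposite. The half logarithms and the one surviving
  \<open>ln (2 * pi) / 2\<close> form the prefactor.\<close>

lemma ln_binom_mass_expansion:
  fixes p t :: real
  assumes "0 < p" "p < 1" "real m = real N * p + t" "0 < m" "m < N"
  shows "ln (binom_mass m N p) =
     - (ln (2 * pi * (real m * (real N - real m) / real N)) / 2) + (\<Sum>k=1..M. A_hat k t p / real N ^ k)
     + ((ln (fact N) - ln (real N) / 2 - stirling_approx M 0 (real N))
        - (ln (fact m) - ln (real m) / 2 - stirling_approx M t (real N * p))
        - (ln (fact (N - m)) - ln (real (N - m)) / 2 - stirling_approx M (- t) (real N * (1 - p))))"
proof -
  have "binom_mass m N p = fact N / (fact m * fact (N - m)) * p ^ m * (1 - p) ^ (N - m)"
    using assms by (simp add: binom_mass_def binomial_fact)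
  also have "ln \<dots> = ln (fact N) - ln (fact m) - ln (fact (N - m))
      + real m * ln p + real (N - m) * ln (1 - p)"
    using assms by (simp add: ln_mult ln_div ln_realpow)
  finally have lnb: "ln (binom_mass m N p) = \<dots>" .
  have lnpre: "ln (2 * pi * (real m * (real N - real m) / real N))
      = ln (2 * pi) + ln (real m) + ln (real (N - m)) - ln (real N)"
    using assms by (simp add: ln_mult ln_div of_nat_diff)
  have sums: "(\<Sum>k=1..M. A_hat k t p / real N ^ k)
     = (\<Sum>k=1..M. (-1) ^ (k + 1) * bernpoly_hat (k + 1) 0 / real (k * (k + 1)) * (1 / real N ^ k))
     - (\<Sum>k=1..M. (-1) ^ (k + 1) * bernpoly_hat (k + 1) t / real (k * (k + 1)) * (1 / (real N * p) ^ k))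
     - (\<Sum>k=1..M. (-1) ^ (k + 1) * bernpoly_hat (k + 1) (- t) / real (k * (k + 1)) * (1 / (real N * (1 - p)) ^ k))"
    unfolding sum_subtractf[symmetric] by (intro sum.cong refl A_hat_eq) simp
  have m: "real N * p + t = real m" "real N * (1 - p) + - t = real (N - m)"
    using assms by (simp_all add: of_nat_diff algebra_simps)
  have ln: "ln (real N * p) = ln (real N) + ln p" "ln (real N * (1 - p)) = ln (real N) + ln (1 - p)"
    using assms by (simp_all add: ln_mult)
  have N: "real (N - m) = real N - real m" using assms by (simp add: of_nat_diff)
  show ?thesis
    unfolding lnb lnpre sums stirling_approx_def m ln N by (simp add: field_simps)
qed

section \<open>From logarithmic to relative errors, and uniformity over compact sets\<close>

lemma abs_exp_minus_1_le:
  fixes r :: real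
  assumes "\<bar>r\<bar> \<le> 1"
  shows "\<bar>exp r - 1\<bar> \<le> 2 * \<bar>r\<bar>"
proof (cases "r \<ge> 0")
  case True
  have "r * r \<le> 1 * r" using True assms by (intro mult_right_mono) auto
  then show ?thesis using exp_bound[of r] True assms by (simp add: power2_eq_square)
next
  case False
  then have "exp r \<le> 1" by simp
  then show ?thesis using exp_ge_add_one_self[of r] False by linarith
qed

text \<open>On a nonempty compact \<open>K\<close> the positive function
  \<open>min p (1 - p)\<close> attains its minimum, which serves as \<open>a\<close>.\<close>

lemma compact_subset_open_unit_interval:
  fixes K :: "real set"
  assumes "compact K" and "K \<subseteq> {0<..<1}"
  obtains a where "0 < a" "\<And>p. p \<in> K \<Longrightarrow> a \<le> p" "\<And>p. p \<in> K \<Longrightarrow> a \<le> 1 - p"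
proof (cases "K = {}")
  case True
  then show ?thesis using that[of 1] by simp
next
  case False
  obtain x where x: "x \<in> K" "\<And>p. p \<in> K \<Longrightarrow> min x (1 - x) \<le> min p (1 - p)"
    using continuous_attains_inf[OF assms(1) False, of "\<lambda>p. min p (1 - p)"]
    by (auto simp: continuous_intros)
  show ?thesis
    by (rule that[of "min x (1 - x)"]) (use x assms(2) in \<open>fastforce simp: min_def split: if_splits\<close>)+
qed

theorem theorem3p3:
  fixes K H :: "real set"
  assumes "compact K" and "K \<subseteq> {0<..<1}" and "compact H"
  shows
    "(\<forall>M::nat. \<exists>(C::real) (N0::nat). \<forall>N\<ge>N0. \<forall>p\<in>K. \<forall>t\<in>H. \<forall>m::nat.
        real m = real N * p + t \<and> m \<le> N \<longrightarrow>
          0 < m \<and> m < N \<and>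
          (\<exists>\<epsilon>::real. \<bar>\<epsilon>\<bar> \<le> C / real N ^ (M + 1) \<and>
             binom_mass m N p =
               1 / sqrt (2 * pi * (real m * (real N - real m) / real N))
                 * exp (\<Sum>k=1..M. A_hat k t p / real N ^ k) * (1 + \<epsilon>)))
     \<and> (\<forall>(p::real) (t::real) (k::nat). 0 < p \<and> p < 1 \<and> 1 \<le> k \<longrightarrow>
          A_hat k t p = A_hat k (- t) (1 - p) \<and>
          A_hat k t p = A_tilde k t p - Xi k p * t ^ k / (2 * real k))"
proof (intro conjI allI impI; (elim conjE)?)
  fix M :: nat
  obtain a where a: "0 < a" "\<And>p. p \<in> K \<Longrightarrow> a \<le> p" "\<And>p. p \<in> K \<Longrightarrow> a \<le> 1 - p"
    by (rule compact_subset_open_unit_interval[OF assms(1,2)]) blast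
  obtain R where R: "R > 0" "\<And>t. t \<in> H \<Longrightarrow> \<bar>t\<bar> \<le> R"
    using compact_imp_bounded[OF assms(3)] unfolding bounded_pos real_norm_def by blast
  obtain C Z where C: "C \<ge> 0" and stirling: "\<And>z t m. z \<ge> Z \<Longrightarrow> \<bar>t\<bar> \<le> R \<Longrightarrow> real m = z + t \<Longrightarrow>
      \<bar>ln (fact m) - ln (real m) / 2 - stirling_approx M t z\<bar> \<le> C / z ^ (M + 1)"
    using ln_fact_stirling[of R M] by blast
  \<comment> \<open>One \<open>C\<close> for \<open>N!\<close>, and \<open>C / a ^ (M + 1)\<close>
    for each of \<open>m!\<close> and \<open>(N - m)!\<close>, since \<open>N p\<close> and
    \<open>N (1 - p)\<close> are at least \<open>N a\<close>.\<close>
  define D where "D = C + 2 * (C / a ^ (M + 1))"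
  have "D \<ge> 0" using C a by (simp add: D_def)
  \<comment> \<open>The bounds \<open>Z\<close> and \<open>Z / a\<close> make the Stirling estimate
    apply to all three factorials; \<open>(R + 1) / a\<close> makes \<open>m\<close> and
    \<open>N - m\<close> positive; 1 and \<open>D\<close> make the logarithmic error at most
    1.\<close>
  obtain N0 :: nat where N0: "real N0 \<ge> max (max 1 D) (max (max Z (Z / a)) ((R + 1) / a))"
    using real_arch_simple by blast
  show "\<exists>C N0. \<forall>N\<ge>N0. \<forall>p\<in>K. \<forall>t\<in>H. \<forall>m::nat.
        real m = real N * p + t \<and> m \<le> N \<longrightarrow>
          0 < m \<and> m < N \<and>
          (\<exists>\<epsilon>::real. \<bar>\<epsilon>\<bar> \<le> C / real N ^ (M + 1) \<and>
             binom_mass m N p =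
               1 / sqrt (2 * pi * (real m * (real N - real m) / real N))
                 * exp (\<Sum>k=1..M. A_hat k t p / real N ^ k) * (1 + \<epsilon>))"
  proof (intro exI[of _ "2 * D"] exI[of _ N0] allI ballI impI; elim conjE)
    fix N m :: nat and p t :: real
    assume N: "N0 \<le> N" and p: "p \<in> K" and t: "t \<in> H" and m: "real m = real N * p + t" and mN: "m \<le> N"
    have N': "real N \<ge> max (max 1 D) (max (max Z (Z / a)) ((R + 1) / a))"
      using N N0 by linarith
    have Na: "Z \<le> real N * a" "R + 1 \<le> real N * a"
      using N' a by (auto simp: pos_divide_le_eq)
    have "0 < p" "p < 1" and pa: "a \<le> p" "a \<le> 1 - p" and tR: "\<bar>t\<bar> \<le> R"
      using p t assms(2) a R by auto
    have Np: "real N * a \<le> real N * p" "real N * a \<le> real N * (1 - p)"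
      using pa by (auto intro!: mult_left_mono)
    have mq: "real (N - m) = real N * (1 - p) + (- t)"
      using m mN by (simp add: of_nat_diff algebra_simps)
    have "real m > 0" using m Na Np tR by linarith
    moreover have "real (N - m) > 0" using mq Na Np tR by linarith
    ultimately have "0 < m" "m < N" by auto
    define r where "r = (ln (fact N) - ln (real N) / 2 - stirling_approx M 0 (real N))
        - (ln (fact m) - ln (real m) / 2 - stirling_approx M t (real N * p))
        - (ln (fact (N - m)) - ln (real (N - m)) / 2 - stirling_approx M (- t) (real N * (1 - p)))"
    have "N > 0" using \<open>m < N\<close> by simp
    have le: "C / z ^ (M + 1) \<le> C / a ^ (M + 1) / real N ^ (M + 1)" if "real N * a \<le> z" for z
    proof -
      have "C / z ^ (M + 1) \<le> C / (real N * a) ^ (M + 1)"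
        using that C a \<open>N > 0\<close> by (intro divide_left_mono power_mono mult_pos_pos zero_less_power)
          (auto intro: less_le_trans[of 0 "real N * a"])
      then show ?thesis by (simp add: power_mult_distrib mult.commute del: power_Suc)
    qed
    have "\<bar>r\<bar> \<le> C / real N ^ (M + 1) + C / (real N * p) ^ (M + 1) + C / (real N * (1 - p)) ^ (M + 1)"
    proof -
      have le: "Z \<le> real N" "Z \<le> real N * p" "Z \<le> real N * (1 - p)"
        using N' Na Np by linarith+
      have "\<bar>ln (fact N) - ln (real N) / 2 - stirling_approx M 0 (real N)\<bar> \<le> C / real N ^ (M + 1)"
        by (rule stirling) (use le R(1) in auto)
      moreover have "\<bar>ln (fact m) - ln (real m) / 2 - stirling_approx M t (real N * p)\<bar>
          \<le> C / (real N * p) ^ (M + 1)"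
        by (rule stirling[OF le(2) tR m])
      moreover have "\<bar>ln (fact (N - m)) - ln (real (N - m)) / 2 - stirling_approx M (- t) (real N * (1 - p))\<bar>
          \<le> C / (real N * (1 - p)) ^ (M + 1)"
        by (rule stirling[OF le(3) _ mq]) (use tR in simp)
      ultimately show ?thesis unfolding r_def by linarith
    qed
    also have "\<dots> \<le> C / real N ^ (M + 1) + C / a ^ (M + 1) / real N ^ (M + 1) + C / a ^ (M + 1) / real N ^ (M + 1)"
      by (intro add_mono le Np order_refl)
    also have "\<dots> = D / real N ^ (M + 1)"
      by (simp add: D_def add_divide_distrib)
    finally have r: "\<bar>r\<bar> \<le> D / real N ^ (M + 1)" .
    also have "\<dots> \<le> 1"
    proof -
      have "real N ^ 1 \<le> real N ^ (M + 1)" using N' by (intro power_increasing) auto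
      moreover have "D \<le> real N ^ 1" using N' by simp
      ultimately have "D \<le> real N ^ (M + 1)" by (rule order_trans[rotated])
      then show ?thesis using \<open>N > 0\<close> by (subst pos_divide_le_eq) auto
    qed
    \<comment> \<open>The relative error is \<open>exp r - 1\<close>; this estimate is the source of
      the factor 2 in the witness \<open>2 * D\<close>.\<close>
    finally have "\<bar>exp r - 1\<bar> \<le> 2 * \<bar>r\<bar>" by (rule abs_exp_minus_1_le)
    with r have eps: "\<bar>exp r - 1\<bar> \<le> 2 * D / real N ^ (M + 1)" by simp
    have pos: "2 * pi * (real m * (real N - real m) / real N) > 0" (is "?y > 0")
      using \<open>0 < m\<close> \<open>m < N\<close> by (intro mult_pos_pos divide_pos_pos) auto
    have "binom_mass m N p > 0"
      using \<open>0 < p\<close> \<open>p < 1\<close> mN by (auto simp: binom_mass_def intro!: mult_pos_pos)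
    then have "binom_mass m N p = exp (ln (binom_mass m N p))" by simp
    also have "\<dots> = exp (- (ln ?y / 2) + (\<Sum>k=1..M. A_hat k t p / real N ^ k) + r)"
      using ln_binom_mass_expansion[OF \<open>0 < p\<close> \<open>p < 1\<close> m \<open>0 < m\<close> \<open>m < N\<close>, of M]
      by (simp only: r_def)
    also have "\<dots> = 1 / exp (ln ?y / 2) * exp (\<Sum>k=1..M. A_hat k t p / real N ^ k) * (1 + (exp r - 1))"
    proof -
      have "exp (- x + S + r) = 1 / exp x * exp S * (1 + (exp r - 1))" for x S :: real
        by (simp only: exp_add exp_minus) (simp add: inverse_eq_divide)
      then show ?thesis .
    qed
    also have "exp (ln ?y / 2) = sqrt ?y"
    proof -
      have "exp (ln y / 2) = sqrt y" if "y > 0" for y :: real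
        using that by (simp add: ln_sqrt[symmetric])
      then show ?thesis using pos .
    qed
    finally show "0 < m \<and> m < N \<and>
          (\<exists>\<epsilon>::real. \<bar>\<epsilon>\<bar> \<le> 2 * D / real N ^ (M + 1) \<and>
             binom_mass m N p =
               1 / sqrt (2 * pi * (real m * (real N - real m) / real N))
                 * exp (\<Sum>k=1..M. A_hat k t p / real N ^ k) * (1 + \<epsilon>))"
      using eps \<open>0 < m\<close> \<open>m < N\<close> by blast
  qed
next
  fix p t :: real and k :: nat
  assume "1 \<le> k"
  show "A_hat k t p = A_hat k (- t) (1 - p)"
    by (rule A_hat_symmetric[symmetric])
  show "A_hat k t p = A_tilde k t p - Xi k p * t ^ k / (2 * real k)"
    using \<open>1 \<le> k\<close> by (rule A_hat_eq_A_tilde)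
qed

end
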